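(* Let $R$ be a unique factorization domain which is not a field. Then: (1) $GD(R)$ is Lindelöf if and only if $R$ has at most countably many nonassociate prime elements. (2) The following statements are equivalent: (a) $GD(R)$ is compact; (b) $GD(R)$ is Noetherian; (c) $R$ has only finitely many nonassociate prime elements.
   Context: For a commutative ring $R$ with nonzero identity and unit group $U(R)$, let $R^\#=R\setminus(U(R)\cup\{0\})$ be the set of nonzero nonunits. For $a,b\in R^\#$ write $a\sim b$ if $aR=bR$; $[a]$ denotes the equivalence class of $a$ and $EC(R^\#)$ the set of equivalence classes. For $a\in R^\#$ put $B_a=\{[b]\in EC(R^\#): b\mid a^n\text{ for some }n\geq 1\}$. The sets $B_a$ ($a\in R^\#$) form a basis of a topology on $EC(R^\#)$; the resulting space is denoted $GD(R)$ (the generalized divisor topology). Having finitely (at most countably) many nonassociate prime elements means that the set of associate classes of prime elements of $R$ is finite (at most countable). Compact (Lindelöf) means every open cover has a finite (countable) subcover; a space is Noetherian if its open sets satisfy the ascending chain condition. *)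

theory Defs
  imports "HOL-Analysis.Lindelof_Spaces" "HOL-Algebra.Ring_Divisibility"
begin

definition nonzero_nonunits :: "('a, 'm) ring_scheme \<Rightarrow> 'a set"
  where "nonzero_nonunits R = carrier R - (Units R \<union> {\<zero>\<^bsub>R\<^esub>})"

definition same_ideal_rel :: "('a, 'm) ring_scheme \<Rightarrow> ('a \<times> 'a) set"
  where "same_ideal_rel R =
    {(a, b). a \<in> nonzero_nonunits R \<and> b \<in> nonzero_nonunits R \<and> PIdl\<^bsub>R\<^esub> a = PIdl\<^bsub>R\<^esub> b}"

definition ideal_class :: "('a, 'm) ring_scheme \<Rightarrow> 'a \<Rightarrow> 'a set"
  where "ideal_class R a = same_ideal_rel R `` {a}"

definition EC :: "('a, 'm) ring_scheme \<Rightarrow> 'a set set"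
  where "EC R = nonzero_nonunits R // same_ideal_rel R"

definition GD_basic :: "('a, 'm) ring_scheme \<Rightarrow> 'a \<Rightarrow> 'a set set"
  where "GD_basic R a =
    {ideal_class R b | b. b \<in> nonzero_nonunits R \<and>
       (\<exists>n::nat. n \<ge> 1 \<and> b divides\<^bsub>R\<^esub> (a [^]\<^bsub>R\<^esub> n))}"

definition GD :: "('a, 'm) ring_scheme \<Rightarrow> 'a set topology"
  where "GD R = topology (arbitrary union_of (\<lambda>U. \<exists>a \<in> nonzero_nonunits R. U = GD_basic R a))"

definition Noetherian_space :: "'a topology \<Rightarrow> bool"
  where "Noetherian_space X \<longleftrightarrow>
    (\<forall>U :: nat \<Rightarrow> 'a set. (\<forall>n. openin X (U n)) \<and> (\<forall>n. U n \<subseteq> U (Suc n)) \<longrightarrow>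
       (\<exists>N. \<forall>n \<ge> N. U n = U N))"

definition prime_classes :: "('a, 'm) ring_scheme \<Rightarrow> 'a set set"
  where "prime_classes R = {ideal_class R p | p. p \<in> carrier R \<and> ring_prime\<^bsub>R\<^esub> p}"

text \<open>
  \<open>topology\<close> in the definition of \<open>GD\<close> is meaningful only if unions of basic sets are closed
  under binary intersection; the following facts establish this for every commutative ring.
\<close>

lemma ideal_class_eq_imp:
  assumes "b \<in> nonzero_nonunits R" "ideal_class R b = ideal_class R c"
  shows "PIdl\<^bsub>R\<^esub> b = PIdl\<^bsub>R\<^esub> c"
  using assms unfolding ideal_class_def same_ideal_rel_def by blast

lemma (in cring) divides_if_PIdl_eq:
  assumes "b \<in> carrier R" "c \<in> carrier R" "PIdl b = PIdl c"
  shows "b divides c"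
proof -
  have "c \<in> PIdl b" using assms cgenideal_self by blast
  then show ?thesis
    using assms m_comm unfolding cgenideal_def factor_def by blast
qed

lemma (in cring) divides_nat_pow:
  assumes "b \<in> carrier R" "c \<in> carrier R" "b divides c"
  shows "(b [^] (n::nat)) divides (c [^] n)"
proof -
  obtain d where d: "d \<in> carrier R" "c = b \<otimes> d"
    using assms(3) unfolding factor_def by blast
  then have "c [^] n = b [^] n \<otimes> d [^] n"
    using assms(1) by (simp add: nat_pow_distrib)
  with d(1) show ?thesis unfolding factor_def by blast
qed

lemma (in cring) GD_basic_iff:
  assumes "a \<in> nonzero_nonunits R" "b \<in> nonzero_nonunits R"
  shows "ideal_class R b \<in> GD_basic R a \<longleftrightarrow> (\<exists>n::nat. n \<ge> 1 \<and> b divides (a [^] n))"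
proof
  assume "ideal_class R b \<in> GD_basic R a"
  then obtain c n where c: "c \<in> nonzero_nonunits R" "ideal_class R b = ideal_class R c"
      and n: "(n::nat) \<ge> 1" "c divides (a [^] n)"
    unfolding GD_basic_def by blast
  have "b divides c"
    using divides_if_PIdl_eq ideal_class_eq_imp[OF assms(2) c(2)] assms(2) c(1)
    unfolding nonzero_nonunits_def by blast
  then have "b divides (a [^] n)"
    using n(2) assms(2) divides_trans unfolding nonzero_nonunits_def by blast
  then show "\<exists>n::nat. n \<ge> 1 \<and> b divides (a [^] n)" using n(1) by blast
qed (use assms in \<open>auto simp: GD_basic_def\<close>)

lemma (in cring) GD_basic_mono:
  assumes "a \<in> nonzero_nonunits R" "c \<in> nonzero_nonunits R" "ideal_class R c \<in> GD_basic R a"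
  shows "GD_basic R c \<subseteq> GD_basic R a"
proof
  fix x assume "x \<in> GD_basic R c"
  then obtain b m where b: "b \<in> nonzero_nonunits R" "x = ideal_class R b"
      and m: "(m::nat) \<ge> 1" "b divides (c [^] m)"
    unfolding GD_basic_def by blast
  obtain n where n: "(n::nat) \<ge> 1" "c divides (a [^] n)"
    using assms GD_basic_iff by blast
  have car: "a \<in> carrier R" "b \<in> carrier R" "c \<in> carrier R"
    using assms b unfolding nonzero_nonunits_def by auto
  have "(c [^] m) divides ((a [^] n) [^] m)"
    using divides_nat_pow n(2) car by simp
  then have "b divides (a [^] (n * m))"
    using m(2) divides_trans car by (metis nat_pow_pow)
  moreover have "n * m \<ge> 1" using m n by simp
  ultimately show "x \<in> GD_basic R a"
    using b assms(1) GD_basic_iff by blast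
qed

lemma (in cring) GD_basic_self:
  assumes "a \<in> nonzero_nonunits R"
  shows "ideal_class R a \<in> GD_basic R a"
proof -
  have "a \<in> carrier R" using assms unfolding nonzero_nonunits_def by blast
  then have "a divides (a [^] (1::nat))" by simp
  then show ?thesis using GD_basic_iff[OF assms assms] by blast
qed

lemma (in cring) istopology_GD:
  "istopology (arbitrary union_of (\<lambda>U. \<exists>a \<in> nonzero_nonunits R. U = GD_basic R a))"
    (is "istopology (arbitrary union_of ?P)")
  unfolding istopology_base_eq
proof (intro allI impI, elim conjE bexE)
  fix S T a b
  assume ab: "a \<in> nonzero_nonunits R" "b \<in> nonzero_nonunits R"
    and ST: "S = GD_basic R a" "T = GD_basic R b"
  define \<U> where "\<U> = {GD_basic R c | c. c \<in> nonzero_nonunits R \<and> ideal_class R c \<in> S \<inter> T}"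
  have "\<Union>\<U> \<subseteq> S \<inter> T" using ab ST GD_basic_mono unfolding \<U>_def by blast
  moreover have "S \<inter> T \<subseteq> \<Union>\<U>"
  proof
    fix x assume x: "x \<in> S \<inter> T"
    then obtain c where "c \<in> nonzero_nonunits R" "x = ideal_class R c"
      unfolding ST GD_basic_def by blast
    with x show "x \<in> \<Union>\<U>" using GD_basic_self unfolding \<U>_def by blast
  qed
  ultimately have "\<Union>\<U> = S \<inter> T" by blast
  moreover have "\<U> \<subseteq> Collect ?P" unfolding \<U>_def by blast
  ultimately show "(arbitrary union_of ?P) (S \<inter> T)"
    unfolding union_of_def arbitrary_def by blast
qed

lemma (in cring) openin_GD:
  "openin (GD R) = arbitrary union_of (\<lambda>U. \<exists>a \<in> nonzero_nonunits R. U = GD_basic R a)"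
  unfolding GD_def using istopology_GD by (rule topology_inverse')

lemma (in cring) topspace_GD: "topspace (GD R) = EC R"
proof
  have sub: "GD_basic R a \<subseteq> EC R" for a
    unfolding GD_basic_def EC_def ideal_class_def by (auto intro: quotientI)
  show "topspace (GD R) \<subseteq> EC R"
    using sub unfolding topspace_def openin_GD union_of_def arbitrary_def by blast
  show "EC R \<subseteq> topspace (GD R)"
  proof
    fix x assume "x \<in> EC R"
    then obtain a where a: "a \<in> nonzero_nonunits R" "x = ideal_class R a"
      unfolding EC_def ideal_class_def by (auto elim: quotientE)
    have "openin (GD R) (GD_basic R a)"
      unfolding openin_GD by (rule union_of_inc) (use a(1) in \<open>auto simp: arbitrary_def\<close>)
    then show "x \<in> topspace (GD R)"
      using a GD_basic_self openin_subset by blast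
  qed
qed

end

theory Submission
  imports Defs "HOL-Analysis.Abstract_Topological_Spaces"
begin

text \<open>
  In a unique factorization domain, a nonzero \<open>b\<close> divides some power of a nonzero \<open>a\<close> exactly when
  every prime dividing \<open>b\<close> divides \<open>a\<close>: the multiplicities are absorbed by the exponent. So the
  basic open set of \<open>a\<close> consists of the classes supported in the finite set of prime classes
  dividing \<open>a\<close>, the \<^emph>\<open>support\<close> of \<open>a\<close> (\<open>GD_basic_eq\<close>, \<open>finite_support\<close>). Both
  parts of the theorem come from two consequences of this description.

  First, a basic open set is determined by a finite set of prime classes. Hence countably many
  prime classes leave only countably many basic open sets, which makes the space second countable
  and so Lindelof; finitely many prime classes leave only finitely many open sets, and every
  ascending chain of them stops.

  Secondly, the class of a prime \<open>p\<close> lies in the basic open set of \<open>a\<close> only if \<open>p\<close> divides \<open>a\<close>. So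
  a subfamily of the basic open sets can only cover the space if the corresponding supports cover
  all prime classes (\<open>prime_classes_covered\<close>). Since each support is finite, a countable subcover
  of the cover by all basic open sets makes the set of prime classes countable, and a finite
  subcover makes it finite.

  The circle of equivalences in the second part closes with the general fact that Noetherian
  spaces are compact (\<open>Noetherian_imp_compact_space\<close>).
\<close>

section \<open>Noetherian spaces\<close>

text \<open>
  If an open cover has no finite subcover, then the union of any finite subfamily is enlarged
  by a further member of the cover; repeating this gives a strictly ascending sequence.
\<close>

lemma Noetherian_imp_compact_space:
  assumes "Noetherian_space X"
  shows "compact_space X"
  unfolding compact_space_alt
proof (intro allI impI, elim conjE, rule ccontr)
  fix \<U>
  assume opn: "\<forall>U\<in>\<U>. openin X U" and cov: "topspace X \<subseteq> \<Union>\<U>"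
    and no_subcover: "\<not> (\<exists>\<F>. finite \<F> \<and> \<F> \<subseteq> \<U> \<and> topspace X \<subseteq> \<Union>\<F>)"
  have step: "\<exists>\<G>. (finite \<G> \<and> \<G> \<subseteq> \<U>) \<and> \<Union>\<F> \<subset> \<Union>\<G>" if \<F>: "finite \<F> \<and> \<F> \<subseteq> \<U>" for \<F>
  proof -
    obtain x where x: "x \<in> topspace X" "x \<notin> \<Union>\<F>"
      using \<F> no_subcover by blast
    then obtain U where U: "U \<in> \<U>" "x \<in> U"
      using cov by blast
    then have "finite (insert U \<F>) \<and> insert U \<F> \<subseteq> \<U>" "\<Union>\<F> \<subset> \<Union>(insert U \<F>)"
      using \<F> x by auto
    then show ?thesis by blast
  qed
  have "\<exists>\<F>. \<forall>n::nat. (finite (\<F> n) \<and> \<F> n \<subseteq> \<U>) \<and> \<Union>(\<F> n) \<subset> \<Union>(\<F> (Suc n))"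
  proof (rule dependent_nat_choice)
    show "\<exists>\<F>. finite \<F> \<and> \<F> \<subseteq> \<U>" by (rule exI[of _ "{}"]) simp
  qed (rule step)
  then obtain \<F> where
    "\<forall>n::nat. (finite (\<F> n) \<and> \<F> n \<subseteq> \<U>) \<and> \<Union>(\<F> n) \<subset> \<Union>(\<F> (Suc n))" ..
  then have \<F>: "finite (\<F> n) \<and> \<F> n \<subseteq> \<U>" "\<Union>(\<F> n) \<subset> \<Union>(\<F> (Suc n))" for n
    by simp_all
  have "openin X (\<Union>(\<F> n))" for n
    using \<F>(1) opn by blast
  moreover have "\<Union>(\<F> n) \<subseteq> \<Union>(\<F> (Suc n))" for n
    using \<F>(2) by (rule psubset_imp_subset)
  ultimately obtain N where "\<forall>n\<ge>N. \<Union>(\<F> n) = \<Union>(\<F> N)"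
    using assms[unfolded Noetherian_space_def, rule_format, of "\<lambda>n. \<Union>(\<F> n)"] by auto
  then have "\<Union>(\<F> (Suc N)) = \<Union>(\<F> N)" by (meson le_SucI order_refl)
  then show False using \<F>(2)[of N] by blast
qed

lemma finite_open_sets_imp_Noetherian_space:
  assumes "finite {U. openin X U}"
  shows "Noetherian_space X"
  unfolding Noetherian_space_def
proof (intro allI impI, elim conjE)
  fix U :: "nat \<Rightarrow> _"
  assume opn: "\<forall>n. openin X (U n)" and asc: "\<forall>n. U n \<subseteq> U (Suc n)"
  have fin: "finite (range U)"
    by (rule finite_subset[OF _ assms]) (use opn in auto)
  have mono: "U m \<subseteq> U n" if "m \<le> n" for m n
    using asc that by (simp add: lift_Suc_mono_le)
  have "U m \<subseteq> U n \<or> U n \<subseteq> U m" for m n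
    using mono[of m n] mono[of n m] by linarith
  then have "subset.chain UNIV (range U)"
    unfolding subset_chain_def by auto
  then have "\<Union>(range U) \<in> range U"
    using fin by (intro Union_in_chain) auto
  then obtain N where N: "\<Union>(range U) = U N" by (elim imageE)
  show "\<exists>N. \<forall>n\<ge>N. U n = U N"
  proof (intro exI allI impI subset_antisym)
    fix n assume "N \<le> n"
    then show "U N \<subseteq> U n" by (rule mono)
    show "U n \<subseteq> U N" unfolding N[symmetric] by blast
  qed
qed

section \<open>Prime supports\<close>

definition support :: "('a, 'm) ring_scheme \<Rightarrow> 'a \<Rightarrow> 'a set set"
  where "support R a =
    {ideal_class R p | p. p \<in> carrier R \<and> ring_prime\<^bsub>R\<^esub> p \<and> p divides\<^bsub>R\<^esub> a}"

lemma support_subset_prime_classes: "support R a \<subseteq> prime_classes R"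
  unfolding support_def prime_classes_def by blast

lemma (in cring) prime_nonzero_nonunit:
  assumes "p \<in> carrier R" "ring_prime p"
  shows "p \<in> nonzero_nonunits R"
  using assms unfolding nonzero_nonunits_def ring_prime_def prime_def by blast

lemma (in cring) prime_dvd_mult:
  assumes "ring_prime p" "a \<in> carrier R" "b \<in> carrier R" "p divides a \<otimes> b"
  shows "p divides a \<or> p divides b"
  using assms unfolding ring_prime_def prime_def by blast

lemma (in cring) prime_dvd_pow:
  assumes "p \<in> carrier R" "ring_prime p" "a \<in> carrier R" "p divides (a [^] (n::nat))"
  shows "p divides a"
  using assms(4)
proof (induction n)
  case 0
  then show ?case
    using assms divides_one[of p] unfolding ring_prime_def prime_def by simp
next
  case (Suc n)
  then show ?case
    using prime_dvd_mult[of p "a [^] n" a] assms by auto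
qed

text \<open>
  If \<open>p = q \<otimes> c\<close>, then \<open>p\<close> divides one of the two factors. It cannot be \<open>c\<close>, because cancelling \<open>p\<close>
  would make \<open>q\<close> a unit; so \<open>p\<close> and \<open>q\<close> divide each other.
\<close>

lemma (in domain) prime_dvd_prime_imp_class_eq:
  assumes p: "p \<in> carrier R" "ring_prime p" and q: "q \<in> carrier R" "ring_prime q"
    and "q divides p"
  shows "ideal_class R q = ideal_class R p"
proof -
  obtain c where c: "c \<in> carrier R" "p = q \<otimes> c"
    using \<open>q divides p\<close> unfolding factor_def by blast
  have nz: "p \<noteq> \<zero>" using p unfolding ring_prime_def by blast
  have "p divides q \<otimes> c" using c(2) p(1) by auto
  then consider "p divides q" | "p divides c"
    using prime_dvd_mult p(2) q(1) c(1) by blast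
  then have "p divides q"
  proof cases
    case 2
    then obtain d where d: "d \<in> carrier R" "c = p \<otimes> d" unfolding factor_def by blast
    have "p \<otimes> (q \<otimes> d) = p \<otimes> \<one>"
      using c(2) d p(1) q(1) by (simp add: m_lcomm)
    then have "q \<otimes> d = \<one>"
      using m_lcancel nz p(1) q(1) d(1) by blast
    then have "q \<in> Units R"
      using d(1) divides_one q(1) by (metis dividesI)
    then show ?thesis
      using q prime_nonzero_nonunit unfolding nonzero_nonunits_def by blast
  qed
  then have "PIdl q = PIdl p"
    using associated_iff_same_ideal[of q p] p(1) q(1) \<open>q divides p\<close> unfolding associated_def by blast
  then show ?thesis
    using prime_nonzero_nonunit[OF p] prime_nonzero_nonunit[OF q]
    unfolding ideal_class_def same_ideal_rel_def by blast
qed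

text \<open>Divisibility by a prime depends only on the class of that prime.\<close>

lemma (in cring) ideal_class_in_support_iff:
  assumes "p \<in> carrier R" "ring_prime p" "a \<in> carrier R"
  shows "ideal_class R p \<in> support R a \<longleftrightarrow> p divides a"
proof
  assume "ideal_class R p \<in> support R a"
  then obtain q where q: "q \<in> carrier R" "q divides a" "ideal_class R p = ideal_class R q"
    unfolding support_def by blast
  have "PIdl p = PIdl q"
    by (rule ideal_class_eq_imp[OF prime_nonzero_nonunit[OF assms(1,2)] q(3)])
  then have "p divides q"
    by (rule divides_if_PIdl_eq[OF assms(1) q(1)])
  then show "p divides a"
    using q(2) assms(1) by (rule divides_trans)
qed (use assms in \<open>auto simp: support_def\<close>)

lemma (in cring) support_unit:
  assumes "u \<in> Units R"
  shows "support R u = {}"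
proof -
  have "\<not> p divides u" if p: "p \<in> carrier R" "ring_prime p" for p
    using assms p divides_unit[of p u] unfolding ring_prime_def prime_def by blast
  then show ?thesis unfolding support_def by blast
qed

lemma (in domain) support_prime_mult_subset:
  assumes "p \<in> carrier R" "ring_prime p" "x \<in> carrier R"
  shows "support R (p \<otimes> x) \<subseteq> insert (ideal_class R p) (support R x)"
proof
  fix c assume "c \<in> support R (p \<otimes> x)"
  then obtain q where q: "q \<in> carrier R" "ring_prime q" "q divides p \<otimes> x" "c = ideal_class R q"
    unfolding support_def by blast
  then consider "q divides p" | "q divides x"
    using prime_dvd_mult[of q p x] assms by blast
  then show "c \<in> insert (ideal_class R p) (support R x)"
  proof cases
    case 1
    then show ?thesis using prime_dvd_prime_imp_class_eq[of p q] q assms by blast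
  next
    case 2
    then show ?thesis using q unfolding support_def by blast
  qed
qed

lemma (in cring) support_prime_mult_supset:
  assumes "p \<in> carrier R" "ring_prime p" "x \<in> carrier R"
  shows "insert (ideal_class R p) (support R x) \<subseteq> support R (p \<otimes> x)"
proof -
  have "p divides p \<otimes> x" using assms by auto
  moreover have "q divides p \<otimes> x" if "q \<in> carrier R" "q divides x" for q
    using divides_prod_l[of q x p] that assms by blast
  ultimately show ?thesis using assms unfolding support_def by blast
qed

lemma (in cring) support_subset_if_divides_pow:
  assumes "a \<in> carrier R" "b divides (a [^] (n::nat))"
  shows "support R b \<subseteq> support R a"
proof -
  have "p divides a" if "p \<in> carrier R" "ring_prime p" "p divides b" for p
    using prime_dvd_pow[of p a n] divides_trans[of p b "a [^] n"] that assms by blast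
  then show ?thesis unfolding support_def by blast
qed

lemma (in cring) divides_pow_0_iff:
  assumes "b \<in> carrier R"
  shows "b divides (a [^] (0::nat)) \<longleftrightarrow> b \<in> Units R"
  using divides_one[OF assms] by simp

lemma (in cring) mult_divides_pow_Suc:
  assumes "a \<in> carrier R" "p \<in> carrier R" "x \<in> carrier R"
    and "p divides a" "x divides (a [^] (n::nat))"
  shows "p \<otimes> x divides (a [^] Suc n)"
proof -
  obtain c d where "c \<in> carrier R" "a = p \<otimes> c" "d \<in> carrier R" "a [^] n = x \<otimes> d"
    using assms(4,5) unfolding factor_def by blast
  then have "a [^] Suc n = (p \<otimes> x) \<otimes> (d \<otimes> c)"
    using assms(2,3) by (simp add: m_ac)
  then show ?thesis
    using \<open>c \<in> carrier R\<close> \<open>d \<in> carrier R\<close> unfolding factor_def by blast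
qed

text \<open>
  The form in which unique factorization enters: a product of irreducibles is built up one prime
  at a time, since irreducibles are prime.
\<close>

lemma (in factorial_domain) nonzero_prime_induct [consumes 2, case_names unit mult]:
  assumes "x \<in> carrier R" "x \<noteq> \<zero>"
    and unit: "\<And>u. u \<in> Units R \<Longrightarrow> P u"
    and mult: "\<And>p x. \<lbrakk>p \<in> carrier R; ring_prime p; x \<in> carrier R; x \<noteq> \<zero>; P x\<rbrakk> \<Longrightarrow> P (p \<otimes> x)"
  shows "P x"
proof (cases "x \<in> Units R")
  case False
  then obtain fs where fs: "set fs \<subseteq> carrier (mult_of R)" "factors (mult_of R) fs x"
    using factors_exist[of x] assms(1,2) by auto
  have prod: "foldr (\<otimes>) fs \<one> \<in> carrier R - {\<zero>} \<and> P (foldr (\<otimes>) fs \<one>)"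
    if "set fs \<subseteq> carrier R - {\<zero>}" "\<forall>f\<in>set fs. irreducible (mult_of R) f" for fs
    using that
  proof (induction fs)
    case Nil
    then show ?case using unit by simp
  next
    case (Cons f fs)
    then have "ring_prime f"
      using irreducible_prime[of f] ring_primeI'[of f] by simp
    then show ?case
      using Cons mult[of f "foldr (\<otimes>) fs \<one>"] integral by auto
  qed
  then show ?thesis
    using fs prod[of fs] unfolding factors_def by simp
qed (rule unit)

lemma (in factorial_domain) finite_support:
  assumes "a \<in> carrier R" "a \<noteq> \<zero>"
  shows "finite (support R a)"
  using assms
proof (induction rule: nonzero_prime_induct)
  case (unit u)
  then show ?case by (simp add: support_unit)
next
  case (mult p x)
  then show ?case
    using support_prime_mult_subset[of p x] finite_subset by blast
qed

text \<open>
  From right to left, one factor \<open>a\<close> of the power is spent on each prime factor of \<open>b\<close>, so the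
  number of prime factors of \<open>b\<close> serves as exponent.
\<close>

lemma (in factorial_domain) divides_some_pow_iff_support_subset:
  assumes "a \<in> carrier R" "b \<in> carrier R" "b \<noteq> \<zero>"
  shows "(\<exists>n::nat. b divides (a [^] n)) \<longleftrightarrow> support R b \<subseteq> support R a"
proof
  assume "\<exists>n::nat. b divides (a [^] n)"
  then show "support R b \<subseteq> support R a"
    using support_subset_if_divides_pow[OF assms(1)] by blast
next
  assume "support R b \<subseteq> support R a"
  with assms(2,3) show "\<exists>n::nat. b divides (a [^] n)"
  proof (induction rule: nonzero_prime_induct)
    case (unit u)
    then have "u divides (a [^] (0::nat))"
      using divides_pow_0_iff unfolding Units_def by blast
    then show ?case ..
  next
    case (mult p x)
    then have sub: "ideal_class R p \<in> support R a" "support R x \<subseteq> support R a"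
      using support_prime_mult_supset[of p x] by blast+
    then obtain n :: nat where n: "x divides (a [^] n)"
      using mult.IH by blast
    have "p divides a"
      using sub(1) ideal_class_in_support_iff[of p a] mult.hyps assms(1) by blast
    then have "p \<otimes> x divides (a [^] Suc n)"
      using mult_divides_pow_Suc[OF assms(1) _ _ _ n] mult.hyps by blast
    then show ?case ..
  qed
qed

section \<open>The generalized divisor topology in terms of supports\<close>

definition supported_classes :: "('a, 'm) ring_scheme \<Rightarrow> 'a set set \<Rightarrow> 'a set set"
  where "supported_classes R S = {ideal_class R b | b. b \<in> nonzero_nonunits R \<and> support R b \<subseteq> S}"

lemma (in factorial_domain) GD_basic_eq:
  assumes "a \<in> nonzero_nonunits R"
  shows "GD_basic R a = supported_classes R (support R a)"
proof -
  have "(\<exists>n::nat. n \<ge> 1 \<and> b divides (a [^] n)) \<longleftrightarrow> support R b \<subseteq> support R a"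
    if b: "b \<in> nonzero_nonunits R" for b
  proof -
    have car: "a \<in> carrier R" "b \<in> carrier R" "b \<noteq> \<zero>"
      using assms b unfolding nonzero_nonunits_def by auto
    \<comment> \<open>A nonunit does not divide \<open>a [^] 0\<close>, so the exponent is positive automatically.\<close>
    have "\<not> b divides (a [^] (0::nat))"
      using b divides_pow_0_iff[OF car(2)] unfolding nonzero_nonunits_def by blast
    then have "(\<exists>n::nat. n \<ge> 1 \<and> b divides (a [^] n)) \<longleftrightarrow> (\<exists>n::nat. b divides (a [^] n))"
      by (metis less_one not_le)
    then show ?thesis
      using divides_some_pow_iff_support_subset car by blast
  qed
  then show ?thesis unfolding GD_basic_def supported_classes_def by blast
qed

lemma (in cring) openin_GD_basic:
  assumes "a \<in> nonzero_nonunits R"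
  shows "openin (GD R) (GD_basic R a)"
  unfolding openin_GD by (rule union_of_inc) (use assms in \<open>auto simp: arbitrary_def\<close>)

lemma (in cring) openin_GD_iff:
  "openin (GD R) U \<longleftrightarrow> (\<exists>\<B> \<subseteq> GD_basic R ` nonzero_nonunits R. U = \<Union>\<B>)"
proof -
  have "Collect (\<lambda>U. \<exists>a\<in>nonzero_nonunits R. U = GD_basic R a) = GD_basic R ` nonzero_nonunits R"
    by (rule image_def[symmetric])
  then show ?thesis
    unfolding openin_GD union_of_def arbitrary_def by (simp add: conj_commute eq_commute)
qed

lemma (in cring) GD_basics_cover: "topspace (GD R) \<subseteq> \<Union>(GD_basic R ` nonzero_nonunits R)"
proof -
  obtain \<B> where "\<B> \<subseteq> GD_basic R ` nonzero_nonunits R \<and> topspace (GD R) = \<Union>\<B>"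
    using iffD1[OF openin_GD_iff openin_topspace] ..
  then show ?thesis using Union_mono[of \<B>] by simp
qed

lemma (in factorial_domain) GD_basics_subset:
  "GD_basic R ` nonzero_nonunits R \<subseteq>
    supported_classes R ` {S. finite S \<and> S \<subseteq> prime_classes R}"
proof (rule image_subsetI)
  fix a assume a: "a \<in> nonzero_nonunits R"
  then have "support R a \<in> {S. finite S \<and> S \<subseteq> prime_classes R}"
    using finite_support[of a] support_subset_prime_classes[of R a]
    unfolding nonzero_nonunits_def by blast
  then show "GD_basic R a \<in> supported_classes R ` {S. finite S \<and> S \<subseteq> prime_classes R}"
    unfolding GD_basic_eq[OF a] by (rule imageI)
qed

lemma (in factorial_domain) prime_classes_covered:
  assumes A: "A \<subseteq> nonzero_nonunits R" and cov: "topspace (GD R) \<subseteq> \<Union>(GD_basic R ` A)"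
  shows "prime_classes R \<subseteq> \<Union>(support R ` A)"
proof
  fix c assume "c \<in> prime_classes R"
  then obtain p where p: "p \<in> carrier R" "ring_prime p" "c = ideal_class R p"
    unfolding prime_classes_def by blast
  note pn = prime_nonzero_nonunit[OF p(1,2)]
  have "c \<in> topspace (GD R)"
    using p(3) GD_basic_self[OF pn] openin_GD_basic[OF pn] openin_subset by blast
  then obtain a where a: "a \<in> A" "c \<in> GD_basic R a" using cov by blast
  then have an: "a \<in> nonzero_nonunits R" using A by blast
  then have car: "a \<in> carrier R" unfolding nonzero_nonunits_def by blast
  obtain n :: nat where "p divides (a [^] n)"
    using a(2) p(3) GD_basic_iff[OF an pn] by blast
  then have "p divides a" using prime_dvd_pow p car by blast
  then show "c \<in> \<Union>(support R ` A)"
    using a(1) p unfolding support_def by blast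
qed

section \<open>Compactness properties and the number of primes\<close>

lemma (in factorial_domain) Lindelof_GD_imp_countable_prime_classes:
  assumes "Lindelof_space (GD R)"
  shows "countable (prime_classes R)"
proof -
  have opn: "\<forall>U\<in>GD_basic R ` nonzero_nonunits R. openin (GD R) U"
    using openin_GD_basic by blast
  obtain \<V> where \<V>: "countable \<V>" "\<V> \<subseteq> GD_basic R ` nonzero_nonunits R" "topspace (GD R) \<subseteq> \<Union>\<V>"
    using assms[unfolded Lindelof_space_alt, THEN spec, THEN mp, OF conjI[OF opn GD_basics_cover]]
    by blast
  obtain A where A: "countable A" "A \<subseteq> nonzero_nonunits R" "\<V> = GD_basic R ` A"
    using \<V>(1,2) countable_subset_image[of \<V> "GD_basic R" "nonzero_nonunits R"] by auto
  have "finite (support R a)" if "a \<in> A" for a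
    using that A(2) finite_support unfolding nonzero_nonunits_def by blast
  then have "countable (\<Union>(support R ` A))"
    using A(1) by (auto intro: countable_finite)
  then show ?thesis
    using countable_subset[OF prime_classes_covered[OF A(2) \<V>(3)[unfolded A(3)]]] by blast
qed

lemma (in factorial_domain) compact_GD_imp_finite_prime_classes:
  assumes "compact_space (GD R)"
  shows "finite (prime_classes R)"
proof -
  have opn: "\<forall>U\<in>GD_basic R ` nonzero_nonunits R. openin (GD R) U"
    using openin_GD_basic by blast
  obtain \<V> where \<V>: "finite \<V>" "\<V> \<subseteq> GD_basic R ` nonzero_nonunits R" "topspace (GD R) \<subseteq> \<Union>\<V>"
    using assms[unfolded compact_space_alt, THEN spec, THEN mp, OF conjI[OF opn GD_basics_cover]]
    by blast
  obtain A where A: "finite A" "A \<subseteq> nonzero_nonunits R" "\<V> = GD_basic R ` A"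
    using finite_subset_image[OF \<V>(1,2)] by blast
  have "finite (support R a)" if "a \<in> A" for a
    using that A(2) finite_support unfolding nonzero_nonunits_def by blast
  then have "finite (\<Union>(support R ` A))"
    using A(1) by blast
  then show ?thesis
    using finite_subset[OF prime_classes_covered[OF A(2) \<V>(3)[unfolded A(3)]]] by blast
qed

lemma (in factorial_domain) countable_prime_classes_imp_Lindelof_GD:
  assumes "countable (prime_classes R)"
  shows "Lindelof_space (GD R)"
proof (rule second_countable_imp_Lindelof_space)
  let ?\<B> = "GD_basic R ` nonzero_nonunits R"
  have "countable ?\<B>"
    by (rule countable_subset[OF GD_basics_subset])
      (intro countable_image countable_Collect_finite_subset assms)
  moreover have "\<forall>V\<in>?\<B>. openin (GD R) V"
    using openin_GD_basic by blast
  moreover have "\<forall>U x. openin (GD R) U \<and> x \<in> U \<longrightarrow> (\<exists>V\<in>?\<B>. x \<in> V \<and> V \<subseteq> U)"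
  proof (intro allI impI)
    fix U x assume "openin (GD R) U \<and> x \<in> U"
    then obtain \<B> where \<B>: "\<B> \<subseteq> ?\<B>" "U = \<Union>\<B>" "x \<in> U"
      unfolding openin_GD_iff by (elim conjE exE)
    obtain V where V: "V \<in> \<B>" "x \<in> V"
      using \<B>(3) unfolding \<B>(2) by (rule UnionE)
    show "\<exists>V\<in>?\<B>. x \<in> V \<and> V \<subseteq> U"
    proof (intro bexI conjI)
      show "V \<subseteq> U" using V(1) \<B>(2) by (simp add: Union_upper)
    qed (use V \<B>(1) in \<open>simp_all add: subsetD\<close>)
  qed
  ultimately show "second_countable (GD R)"
    unfolding second_countable_def by (intro exI[of _ ?\<B>] conjI)
qed

lemma (in factorial_domain) finite_prime_classes_imp_Noetherian_GD:
  assumes "finite (prime_classes R)"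
  shows "Noetherian_space (GD R)"
proof (rule finite_open_sets_imp_Noetherian_space)
  have "finite (GD_basic R ` nonzero_nonunits R)"
    by (rule finite_subset[OF GD_basics_subset]) (use assms in simp)
  then have "finite (Union ` Pow (GD_basic R ` nonzero_nonunits R))"
    by simp
  moreover have "{U. openin (GD R) U} \<subseteq> Union ` Pow (GD_basic R ` nonzero_nonunits R)"
    unfolding openin_GD_iff by (auto simp: image_iff)
  ultimately show "finite {U. openin (GD R) U}"
    by (rule rev_finite_subset)
qed

theorem corollary4p12:
  fixes R :: "('a, 'm) ring_scheme" (structure)
  assumes "factorial_domain R" and "\<not> field R"
  shows "(Lindelof_space (GD R) \<longleftrightarrow> countable (prime_classes R)) \<and>
    (compact_space (GD R) \<longleftrightarrow> Noetherian_space (GD R)) \<and>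
    (Noetherian_space (GD R) \<longleftrightarrow> finite (prime_classes R))"
proof (intro conjI iffI)
  note UFD = \<open>factorial_domain R\<close>
  show "countable (prime_classes R)" if "Lindelof_space (GD R)"
    using that by (rule factorial_domain.Lindelof_GD_imp_countable_prime_classes[OF UFD])
  show "Lindelof_space (GD R)" if "countable (prime_classes R)"
    using that by (rule factorial_domain.countable_prime_classes_imp_Lindelof_GD[OF UFD])
  have finite: "finite (prime_classes R)" if "compact_space (GD R)"
    using that by (rule factorial_domain.compact_GD_imp_finite_prime_classes[OF UFD])
  show Noetherian: "Noetherian_space (GD R)" if "finite (prime_classes R)"
    using that by (rule factorial_domain.finite_prime_classes_imp_Noetherian_GD[OF UFD])
  show compact: "compact_space (GD R)" if "Noetherian_space (GD R)"
    using that by (rule Noetherian_imp_compact_space)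
  show "Noetherian_space (GD R)" if "compact_space (GD R)"
    using that by (rule Noetherian[OF finite])
  show "finite (prime_classes R)" if "Noetherian_space (GD R)"
    using that by (rule finite[OF compact])
qed

end
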